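(* Let $0<\varepsilon<1/3$. Consider an instance of the Tucker packing problem with shape $(I_1,\dots,I_N)\in\mathbb{Z}_{\ge1}^N$, non-increasing sequences $\mathbf{a}^{(n)}\in\mathbb{R}_{\ge0}^{I_n}$, and budget $c\ge1+\sum_{n=1}^NI_n$. Then the algorithm TuckerPackingSolver (described below) returns a feasible core shape $\mathbf{r}$ with $f(\mathbf{r})\ge(1-3\varepsilon)f(\mathbf{r}^* )$, where $\mathbf{r}^*$ is an optimal solution of the Tucker packing instance, and it runs in time \[O\Big(\big(\log_{1+\varepsilon}(c)+\lceil1/\varepsilon\rceil\textstyle\sum_{n=1}^NI_n\big)\big(\textstyle\sum_{n=1}^NI_n\big)^{O(1/\varepsilon)}\Big).\]
   Context: $[k]=\{1,\dots,k\}$; $f(\mathbf{r})=\sum_{n=1}^N\sum_{i_n=1}^{R_n}a^{(n)}_{i_n}$ for $\mathbf{r}=(R_1,\dots,R_N)$. The Tucker packing problem: maximize $f(\mathbf{r})$ over $\mathbf{r}\in[I_1]\times\cdots\times[I_N]$ subject to $\prod_{n}R_n+\sum_nI_nR_n\le c$. Algorithm TuckerPackingSolver (input: the instance and $\varepsilon$): initialize $S=\emptyset$. (Small phase) For each integer $c_{\mathrm{factor}}\in[\lceil1/\varepsilon\rceil\sum_nI_n]$, compute a $(1-\varepsilon)$-approximate solution $\mathbf{r}'$ to: maximize $f(\mathbf{r})$ subject to $\prod_nR_n\le c-c_{\mathrm{factor}}$, $\sum_nI_nR_n\le c_{\mathrm{factor}}$, $R_n\in[\min(\lceil1/\varepsilon\rceil,I_n)]$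 for all $n$; add $\mathbf{r}'$ to $S$. (Large phase) For $k=0,1,\dots,\lfloor\log_{1+\varepsilon}c\rfloor$, set $c_{\mathrm{core}}=(1+\varepsilon)^k$ and compute a $(1-\varepsilon)$-approximate solution $\mathbf{r}^{(k)}$ to: maximize $f(\mathbf{r})$ subject to $\prod_nR_n\le c_{\mathrm{core}}$, $\sum_nI_nR_n\le c-c_{\mathrm{core}}$, $R_n\in[I_n]$ for all $n$; add $\mathbf{r}^{(k)}$ to $S$. Return $\operatorname{argmax}_{\mathbf{r}\in S}f(\mathbf{r})$. Each subproblem is solved as follows: writing $p^{(n)}_i=\sum_{j\le i}a^{(n)}_j$ and using 0-1 variables $x^{(n)}_{i}$ (choose exactly one $i$ per $n$, meaning $R_n=i$), the product constraint $\prod_nR_n\le C$ becomes the linear constraint $\sum_n\sum_i\log(i)x^{(n)}_i\le\log C$ and $\sum_nI_nR_n\le C'$ becomes $\sum_n\sum_iI_n\,i\,x^{(n)}_i\le C'$; this is a 2-dimensional knapsack problem with a partition matroid constraint on $m=\sum_nI_n$ items with objective $\sum_n\sum_ip^{(n)}_ix^{(n)}_i$, and it is solved to within a factor $(1-\varepsilon)$ by the polynomial-time approximation scheme of Grandoni et al. for the $d$-budgeted matroid independent set problem, which runs in time $m^{O(d^2/\varepsilon)}$ (here $d=2$).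
   Formalization: The factor constraint is given to the independent-set solver as sum of I_n(R_n-1) <= C' - sum of I_n, and modes left unchosen get R_n=1, because the unshifted constraint can force the solver to leave a mode unchosen and yield no feasible core shape. *)

theory Defs
  imports Complex_Main "HOL-Library.Monad_Syntax"
begin

section \<open>Timed computations\<close>

text \<open>
  A timed computation is a value together with the number of elementary steps spent on it.
  The machine is a real RAM: an arithmetic operation on reals (including logarithm, floor and
  ceiling), a comparison and an array access each cost one step. \<open>charge t v\<close> is used where
  \<open>v\<close> is obtained from available data by at most \<open>t\<close> such operations (up to a constant
  factor that depends on nothing).
\<close>

type_synonym 'a timed = "'a \<times> nat"

definition charge :: "nat \<Rightarrow> 'a \<Rightarrow> 'a timed" where
  "charge t v = (v, t)"

definition bind_timed :: "'a timed \<Rightarrow> ('a \<Rightarrow> 'b timed) \<Rightarrow> 'b timed" where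
  "bind_timed m f = (fst (f (fst m)), snd m + snd (f (fst m)))"

adhoc_overloading Monad_Syntax.bind \<rightleftharpoons> bind_timed

section \<open>The Tucker packing problem\<close>

text \<open>
  The shape is the list \<open>I\<close>, the \<open>n\<close>-th sequence is the list \<open>a ! n\<close>. List positions
  start at 0, so the mathematical \<open>a\<^sup>(\<^sup>n\<^sup>+\<^sup>1\<^sup>)\<close> with index \<open>i + 1\<close> is \<open>a ! n ! i\<close>. The entries of a
  core shape are the numbers \<open>R\<close> themselves and start at 1.
\<close>

definition tucker_instance :: "nat list \<Rightarrow> real list list \<Rightarrow> real \<Rightarrow> bool" where
  "tucker_instance I a c \<longleftrightarrow>
     I \<noteq> [] \<and> (\<forall>i\<in>set I. 1 \<le> i) \<and> map length a = I \<and>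
     (\<forall>xs\<in>set a. sorted_wrt (\<ge>) xs \<and> (\<forall>x\<in>set xs. 0 \<le> x)) \<and>
     1 + real (sum_list I) \<le> c"

definition objective :: "real list list \<Rightarrow> nat list \<Rightarrow> real" where
  "objective a r = (\<Sum>n<length r. \<Sum>i<r ! n. a ! n ! i)"

definition feasible :: "nat list \<Rightarrow> real \<Rightarrow> nat list \<Rightarrow> bool" where
  "feasible I c r \<longleftrightarrow>
     length r = length I \<and> (\<forall>n<length I. 1 \<le> r ! n \<and> r ! n \<le> I ! n) \<and>
     real (\<Prod>n<length I. r ! n) + real (\<Sum>n<length I. I ! n * r ! n) \<le> c"

definition optimal :: "nat list \<Rightarrow> real list list \<Rightarrow> real \<Rightarrow> nat list \<Rightarrow> bool" where
  "optimal I a c r \<longleftrightarrow>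
     feasible I c r \<and> (\<forall>r'. feasible I c r' \<longrightarrow> objective a r' \<le> objective a r)"

section \<open>The budgeted matroid independent set problem\<close>

definition matroid :: "'e set \<Rightarrow> ('e set \<Rightarrow> bool) \<Rightarrow> bool" where
  "matroid E indep \<longleftrightarrow>
     finite E \<and> (\<forall>X. indep X \<longrightarrow> X \<subseteq> E) \<and> indep {} \<and>
     (\<forall>X Y. indep X \<and> Y \<subseteq> X \<longrightarrow> indep Y) \<and>
     (\<forall>X Y. indep X \<and> indep Y \<and> card X < card Y \<longrightarrow> (\<exists>y\<in>Y - X. indep (insert y X)))"

text \<open>
  The ground set is \<open>{..<m}\<close>, where \<open>m\<close> is the length of the list of profits. A budget
  constraint is a pair of a weight list and a bound; a \<open>d\<close>-budgeted instance has \<open>d\<close> of them.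
\<close>

definition budgeted_feasible ::
    "(nat set \<Rightarrow> bool) \<Rightarrow> (real list \<times> real) list \<Rightarrow> nat set \<Rightarrow> bool" where
  "budgeted_feasible indep constraints S \<longleftrightarrow>
     indep S \<and> (\<forall>(w, B)\<in>set constraints. (\<Sum>j\<in>S. w ! j) \<le> B)"

definition budgeted_instance ::
    "(nat set \<Rightarrow> bool) \<Rightarrow> real list \<Rightarrow> (real list \<times> real) list \<Rightarrow> bool" where
  "budgeted_instance indep profits constraints \<longleftrightarrow>
     matroid {..<length profits} indep \<and> (\<forall>p\<in>set profits. 0 \<le> p) \<and>
     (\<forall>(w, B)\<in>set constraints. length w = length profits \<and> (\<forall>x\<in>set w. 0 \<le> x) \<and> 0 \<le> B)"

text \<open>
  A solver receives the accuracy, the profits, the budget constraints and a timed independence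
  oracle that is queried on duplicate-free lists of elements.
\<close>

type_synonym matroid_solver =
  "real \<Rightarrow> real list \<Rightarrow> (real list \<times> real) list \<Rightarrow> (nat list \<Rightarrow> bool timed) \<Rightarrow> nat list timed"

definition oracle_for ::
    "(nat list \<Rightarrow> bool timed) \<Rightarrow> nat \<Rightarrow> (nat set \<Rightarrow> bool) \<Rightarrow> nat \<Rightarrow> bool" where
  "oracle_for query m indep q \<longleftrightarrow>
     (\<forall>js. distinct js \<and> set js \<subseteq> {..<m} \<longrightarrow>
        fst (query js) = indep (set js) \<and> snd (query js) \<le> q)"

text \<open>
  The guarantee of Grandoni et al. for \<open>d\<close> budgets: a \<open>(1 - \<epsilon>)\<close>-approximate independent set
  in time \<open>m\<close> to the power \<open>O(d\<^sup>2/\<epsilon>)\<close>, where a step may also be an oracle query, which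
  takes time at most \<open>q\<close>.
\<close>

definition budgeted_matroid_ptas :: "nat \<Rightarrow> matroid_solver \<Rightarrow> bool" where
  "budgeted_matroid_ptas d solver \<longleftrightarrow>
     (\<exists>C K :: real. 0 < C \<and> 0 < K \<and>
       (\<forall>\<epsilon> profits constraints query indep q.
          0 < \<epsilon> \<and> \<epsilon> < 1 \<and> profits \<noteq> [] \<and> length constraints = d \<and>
          budgeted_instance indep profits constraints \<and>
          1 \<le> q \<and> oracle_for query (length profits) indep q \<longrightarrow>
          (let (js, t) = solver \<epsilon> profits constraints query in
             distinct js \<and> budgeted_feasible indep constraints (set js) \<and>
             (\<forall>S. budgeted_feasible indep constraints S \<longrightarrow>
                (1 - \<epsilon>) * (\<Sum>j\<in>S. profits ! j) \<le> (\<Sum>j\<in>set js. profits ! j)) \<and>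
             real t \<le> C * real q * real (length profits) powr (K * (real d)\<^sup>2 / \<epsilon>))))"

section \<open>The algorithm\<close>

text \<open>
  Partition matroid: element \<open>j\<close> lies in part \<open>part ! j\<close>, and a set is independent iff it has
  at most one element in each part.
\<close>

fun hits_part :: "nat list \<Rightarrow> nat \<Rightarrow> nat list \<Rightarrow> bool timed" where
  "hits_part part b [] = charge 1 False"
| "hits_part part b (j # js) = do {
     hit \<leftarrow> charge 1 (part ! j = b);
     if hit then charge 1 True else hits_part part b js
   }"

fun partition_query :: "nat list \<Rightarrow> nat list \<Rightarrow> bool timed" where
  "partition_query part [] = charge 1 True"
| "partition_query part (j # js) = do {
     hit \<leftarrow> hits_part part (part ! j) js;
     if hit then charge 1 False else partition_query part js
   }"

text \<open>
  The item \<open>(n, i)\<close> stands for the choice \<open>R\<^sub>n = i\<close>; here \<open>U\<close> lists the upper bounds on the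
  \<open>R\<^sub>n\<close>.
\<close>

definition items :: "nat list \<Rightarrow> (nat \<times> nat) list" where
  "items U = concat (map (\<lambda>n. map (\<lambda>i. (n, i)) [1..<Suc (U ! n)]) [0..<length U])"

definition decode :: "nat \<Rightarrow> (nat \<times> nat) list \<Rightarrow> nat list \<Rightarrow> nat list" where
  "decode N its js = foldl (\<lambda>r j. let (n, i) = its ! j in r[n := i]) (replicate N 1) js"

text \<open>
  \<open>solve_subproblem\<close> maximizes \<open>objective a r\<close> subject to \<open>\<Prod>R\<^sub>n \<le> C\<close>,
  \<open>\<Sum>I\<^sub>nR\<^sub>n \<le> C'\<close> and \<open>1 \<le> R\<^sub>n \<le> U\<^sub>n\<close>. If \<open>r = (1,\<dots>,1)\<close> violates a constraint, nothing is
  feasible and the result is \<open>None\<close>.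

  The subproblem asks for exactly one item per part, whereas the matroid problem only allows at
  most one. For a choice of exactly one item per part, \<open>\<Sum>I\<^sub>nR\<^sub>n \<le> C'\<close> says the same as
  \<open>\<Sum>I\<^sub>n(R\<^sub>n - 1) \<le> C' - \<Sum>I\<^sub>n\<close>. In the second form the item \<open>(n, 1)\<close> has weight 0 in both
  constraints (as \<open>ln 1 = 0\<close>), so it can be added to any independent set that misses part
  \<open>n\<close>; this is what the initial value of \<open>decode\<close> does.
\<close>

definition solve_subproblem ::
    "matroid_solver \<Rightarrow> real \<Rightarrow> nat list \<Rightarrow> real list list \<Rightarrow> nat list \<Rightarrow> real \<Rightarrow> real
     \<Rightarrow> nat list option timed" where
  "solve_subproblem solver \<epsilon> I a U C C' = do {
     s \<leftarrow> charge (length I) (sum_list I);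
     infeasible \<leftarrow> charge 2 (C < 1 \<or> C' < real s);
     if infeasible then charge 1 None
     else do {
       its \<leftarrow> charge (length U + sum_list U) (items U);
       profits \<leftarrow> charge (\<Sum>(n, i)\<leftarrow>its. i) (map (\<lambda>(n, i). \<Sum>j<i. a ! n ! j) its);
       logs \<leftarrow> charge (length its) (map (\<lambda>(n, i). ln (real i)) its);
       factors \<leftarrow> charge (2 * length its) (map (\<lambda>(n, i). real (I ! n * (i - 1))) its);
       part \<leftarrow> charge (length its) (map fst its);
       chosen \<leftarrow> solver \<epsilon> profits [(logs, ln C), (factors, C' - real s)] (partition_query part);
       r \<leftarrow> charge (length U + 2 * length chosen) (decode (length U) its chosen);
       charge 1 (Some r)
     }
   }"

fun collect :: "('a \<Rightarrow> 'b option timed) \<Rightarrow> 'a list \<Rightarrow> 'b list timed" where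
  "collect f [] = charge 1 []"
| "collect f (x # xs) = do {
     y \<leftarrow> f x;
     ys \<leftarrow> collect f xs;
     charge 1 (case y of None \<Rightarrow> ys | Some z \<Rightarrow> z # ys)
   }"

definition timed_objective :: "real list list \<Rightarrow> nat list \<Rightarrow> real timed" where
  "timed_objective a r = charge (length r + sum_list r) (objective a r)"

fun timed_argmax :: "('a \<Rightarrow> real timed) \<Rightarrow> 'a list \<Rightarrow> 'a option timed" where
  "timed_argmax f [] = charge 1 None"
| "timed_argmax f (x # xs) = do {
     best \<leftarrow> timed_argmax f xs;
     (case best of
        None \<Rightarrow> charge 1 (Some x)
      | Some y \<Rightarrow> do {
          u \<leftarrow> f x;
          v \<leftarrow> f y;
          charge 1 (Some (if v \<le> u then x else y))
        })
   }"

text \<open>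
  The list of all \<open>(1 + \<epsilon>)\<^sup>k\<close> is computed by one multiplication per entry. The result is
  \<open>None\<close> only if no subproblem is feasible.
\<close>

definition tucker_packing_solver ::
    "matroid_solver \<Rightarrow> real \<Rightarrow> nat list \<Rightarrow> real list list \<Rightarrow> real \<Rightarrow> nat list option timed" where
  "tucker_packing_solver solver \<epsilon> I a c = do {
     h \<leftarrow> charge 2 (nat \<lceil>1 / \<epsilon>\<rceil>);
     s \<leftarrow> charge (length I) (sum_list I);
     U \<leftarrow> charge (length I) (map (min h) I);
     c_factors \<leftarrow> charge (h * s) [1..<Suc (h * s)];
     S_small \<leftarrow> collect
       (\<lambda>c_factor. solve_subproblem solver \<epsilon> I a U (c - real c_factor) (real c_factor)) c_factors;
     k_max \<leftarrow> charge 2 (nat \<lfloor>log (1 + \<epsilon>) c\<rfloor>);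
     c_cores \<leftarrow> charge (k_max + 1) (map (\<lambda>k. (1 + \<epsilon>) ^ k) [0..<Suc k_max]);
     S_large \<leftarrow> collect
       (\<lambda>c_core. solve_subproblem solver \<epsilon> I a I c_core (c - c_core)) c_cores;
     S \<leftarrow> charge (length S_small) (S_small @ S_large);
     timed_argmax (timed_objective a) S
   }"

end

theory Submission
  imports Defs
begin

text \<open>
  Every feasible core shape is matched, up to a factor \<open>1 - 2\<epsilon>\<close>, by a shape that is feasible for one
  of the enumerated subproblems. If all its coordinates are at most \<open>\<lceil>1 / \<epsilon>\<rceil>\<close>, then its factor size
  is itself one of the enumerated values. Otherwise a coordinate exceeding \<open>1 / \<epsilon>\<close> is divided by
  \<open>1 + \<epsilon>\<close>, so that the core fits into the next lower power of \<open>1 + \<epsilon>\<close>. Solving the subproblem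
  costs another factor \<open>1 - \<epsilon>\<close>.
\<close>

text \<open>Neither enumeration suffices alone. The tried factor sizes stop at
  \<open>\<lceil>1 / \<epsilon>\<rceil> * sum_list I\<close>, so a shape with a coordinate beyond
  \<open>\<lceil>1 / \<epsilon>\<rceil>\<close> may be missed. The tried core sizes form a geometric
  grid, and fitting a core into the grid point below it can require shrinking the product by nearly
  \<open>1 + \<epsilon>\<close>. Small coordinates cannot pay for this: lowering 2 to 1 may halve
  the contribution, and 1 cannot be lowered at all. One coordinate above
  \<open>1 / \<epsilon>\<close> can pay for the whole product, because the loss from integrality is
  then at most an \<epsilon>-fraction of it. Rounding the core size down, not up, leaves enough
  budget for the factors.

  The other obstacle is uniformity of the time bound: its constants may depend on the matroid solver
  only. Everything spent around a call of the solver, including the cost of its oracle queries, is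
  at most quadratic in \<open>sum_list I\<close>, and \<open>\<epsilon> < 1 / 3\<close> lets the
  exponent absorb a square.\<close>

lemma bind_timed_simps [simp]:
  "fst (bind_timed m f) = fst (f (fst m))"
  "snd (bind_timed m f) = snd m + snd (f (fst m))"
  by (simp_all add: bind_timed_def)

lemma charge_simps [simp]: "fst (charge t v) = v" "snd (charge t v) = t"
  by (simp_all add: charge_def)

section \<open>The partition matroid and its independence oracle\<close>

text \<open>Having at most one element per part is injectivity of the part map \<open>p\<close>.
  Exchange is then a pigeonhole argument: \<open>Y\<close> meets \<open>card Y\<close> parts and
  \<open>X\<close> only \<open>card X\<close>, so \<open>Y\<close> has an element in a part that
  \<open>X\<close> misses.\<close>

lemma matroid_partition:
  assumes "finite E"
  shows "matroid E (\<lambda>X. X \<subseteq> E \<and> inj_on p X)"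
  unfolding matroid_def
proof (intro conjI allI impI)
  fix X Y assume XY: "(X \<subseteq> E \<and> inj_on p X) \<and> (Y \<subseteq> E \<and> inj_on p Y) \<and> card X < card Y"
  then have "finite X" using assms finite_subset by blast
  have "\<not> p ` Y \<subseteq> p ` X"
  proof
    assume "p ` Y \<subseteq> p ` X"
    then have "card (p ` Y) \<le> card (p ` X)"
      using \<open>finite X\<close> by (simp add: card_mono)
    then show False using XY by (simp add: card_image)
  qed
  then obtain y where "y \<in> Y" "p y \<notin> p ` X" by blast
  then show "\<exists>y\<in>Y - X. insert y X \<subseteq> E \<and> inj_on p (insert y X)"
    using XY by (intro bexI[of _ y]) auto
qed (use assms in \<open>auto intro: inj_on_subset\<close>)

lemma hits_part_correct: "fst (hits_part part b js) \<longleftrightarrow> (\<exists>j\<in>set js. part ! j = b)"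
  by (induction js) auto

lemma hits_part_time: "snd (hits_part part b js) \<le> length js + 1"
  by (induction js) auto

text \<open>The query compares list positions, so a repeated element would collide with itself
  although its set is independent; distinctness rules this out.\<close>

lemma partition_query_correct:
  "distinct js \<Longrightarrow> fst (partition_query part js) \<longleftrightarrow> inj_on ((!) part) (set js)"
  by (induction js) (auto simp: hits_part_correct inj_on_def)

lemma partition_query_time: "snd (partition_query part js) \<le> (length js)\<^sup>2 + 1"
proof (induction js)
  case (Cons j js)
  then show ?case
    using hits_part_time[of part "part ! j" js] by (auto simp: power2_eq_square)
qed simp

text \<open>A duplicate-free list of elements below \<open>m\<close> has length at most
  \<open>m\<close>, which turns the length-dependent cost of the query into the uniform query cost
  that the guarantee of the solver asks for.\<close>

lemma oracle_for_partition_query: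
  "oracle_for (partition_query part) m (\<lambda>X. X \<subseteq> {..<m} \<and> inj_on ((!) part) X) (m\<^sup>2 + 1)"
  unfolding oracle_for_def
proof (intro allI impI)
  fix js :: "nat list" assume js: "distinct js \<and> set js \<subseteq> {..<m}"
  then have "length js \<le> m"
    using card_mono[of "{..<m}" "set js"] by (simp add: distinct_card)
  then have "(length js)\<^sup>2 \<le> m\<^sup>2" by (simp add: power_mono)
  then show "fst (partition_query part js) = (set js \<subseteq> {..<m} \<and> inj_on ((!) part) (set js)) \<and>
      snd (partition_query part js) \<le> m\<^sup>2 + 1"
    using js partition_query_correct[of js part] partition_query_time[of part js] by linarith
qed

section \<open>Core shapes as sets of items\<close>

lemma set_items: "set (items U) = {(n, i). n < length U \<and> 1 \<le> i \<and> i \<le> U ! n}"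
  by (auto simp: items_def image_iff simp del: upt_Suc)

lemma length_items: "length (items U) = sum_list U"
proof -
  have "map (\<lambda>n. U ! n) [0..<length U] = U" by (rule map_nth)
  then show ?thesis by (simp add: items_def length_concat comp_def del: upt_Suc)
qed

lemma length_decode [simp]: "length (decode N its js) = N"
proof -
  have "length (foldl (\<lambda>r j. let (n, i) = its ! j in r[n := i]) r js) = length r" for r
    by (induction js arbitrary: r) (auto simp: Let_def split: prod.splits)
  then show ?thesis by (simp add: decode_def)
qed

lemma decode_snoc:
  "decode N its (js @ [j]) = (decode N its js)[fst (its ! j) := snd (its ! j)]"
  by (simp add: decode_def case_prod_beta Let_def)

lemma decode_nth_unchosen:
  assumes "n \<notin> (\<lambda>j. fst (its ! j)) ` set js" "n < N"
  shows "decode N its js ! n = 1"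
  using assms by (induction js rule: rev_induct) (auto simp: decode_snoc, simp add: decode_def)

text \<open>Chosen items lie in different parts, so no later update overwrites an earlier
  one.\<close>

lemma decode_nth_chosen:
  assumes "distinct js" "inj_on (\<lambda>j. fst (its ! j)) (set js)" "j \<in> set js" "fst (its ! j) < N"
  shows "decode N its js ! fst (its ! j) = snd (its ! j)"
  using assms
proof (induction js rule: rev_induct)
  case (snoc k js)
  then show ?case
    by (cases "j = k") (auto simp: decode_snoc nth_list_update inj_on_def)
qed simp

text \<open>With \<open>g\<close> arbitrary, one identity serves both budget constraints and the
  profit. The last sum comes from the coordinates left at their default 1; it vanishes for the two
  weights and is nonnegative for the profit.\<close>

lemma sum_decode:
  fixes g :: "nat \<Rightarrow> nat \<Rightarrow> real"
  assumes "distinct js" and inj: "inj_on (\<lambda>j. fst (its ! j)) (set js)"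
    and bound: "\<And>j. j \<in> set js \<Longrightarrow> fst (its ! j) < N"
  shows "(\<Sum>n<N. g n (decode N its js ! n)) =
    (\<Sum>j\<in>set js. case_prod g (its ! j)) +
    (\<Sum>n\<in>{..<N} - (\<lambda>j. fst (its ! j)) ` set js. g n 1)"
proof -
  let ?P = "(\<lambda>j. fst (its ! j)) ` set js"
  have "(\<Sum>n<N. g n (decode N its js ! n)) =
      (\<Sum>n\<in>?P. g n (decode N its js ! n)) + (\<Sum>n\<in>{..<N} - ?P. g n (decode N its js ! n))"
    using bound by (subst add.commute, intro sum.subset_diff) auto
  also have "(\<Sum>n\<in>?P. g n (decode N its js ! n)) = (\<Sum>j\<in>set js. case_prod g (its ! j))"
    using assms by (auto simp: sum.reindex case_prod_beta decode_nth_chosen intro!: sum.cong)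
  also have "(\<Sum>n\<in>{..<N} - ?P. g n (decode N its js ! n)) = (\<Sum>n\<in>{..<N} - ?P. g n 1)"
    by (intro sum.cong) (auto simp: decode_nth_unchosen)
  finally show ?thesis .
qed

text \<open>The converse of decoding: a shape selects one item from each part. The function
  \<open>g\<close> is quantified inside the existential because one and the same \<open>S\<close>
  has to carry the objective and both constraints.\<close>

lemma sum_items:
  assumes r: "\<forall>n<length U. 1 \<le> r ! n \<and> r ! n \<le> U ! n"
  shows "\<exists>S \<subseteq> {..<length (items U)}. inj_on (\<lambda>j. fst (items U ! j)) S \<and>
    (\<forall>g :: nat \<Rightarrow> nat \<Rightarrow> real.
      (\<Sum>j\<in>S. case_prod g (items U ! j)) = (\<Sum>n<length U. g n (r ! n)))"
proof -
  let ?its = "items U"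
  have "\<forall>n<length U. \<exists>j<length ?its. ?its ! j = (n, r ! n)"
    using r by (auto simp: in_set_conv_nth[symmetric] set_items)
  then obtain j where j: "\<And>n. n < length U \<Longrightarrow> j n < length ?its \<and> ?its ! (j n) = (n, r ! n)"
    by metis
  have "inj_on j {..<length U}"
    using j by (intro inj_onI) (metis fst_conv lessThan_iff)
  then have "(\<Sum>k\<in>j ` {..<length U}. case_prod g (?its ! k)) = (\<Sum>n<length U. g n (r ! n))"
    for g :: "nat \<Rightarrow> nat \<Rightarrow> real"
    by (auto simp: sum.reindex j intro!: sum.cong)
  moreover have "inj_on (\<lambda>k. fst (?its ! k)) (j ` {..<length U})"
    by (auto simp: inj_on_def j)
  ultimately show ?thesis
    using j by (intro exI[of _ "j ` {..<length U}"]) auto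
qed

section \<open>Linearization of a subproblem\<close>

text \<open>The bounds \<open>U\<close> are separate from the shape \<open>I\<close>: the small
  phase truncates the range of each coordinate, while the factor weights remain those of
  \<open>I\<close>.\<close>

definition subfeasible :: "nat list \<Rightarrow> nat list \<Rightarrow> real \<Rightarrow> real \<Rightarrow> nat list \<Rightarrow> bool" where
  "subfeasible I U C C' r \<longleftrightarrow>
     length r = length I \<and> (\<forall>n<length I. 1 \<le> r ! n \<and> r ! n \<le> U ! n) \<and>
     real (\<Prod>n<length I. r ! n) \<le> C \<and> real (\<Sum>n<length I. I ! n * r ! n) \<le> C'"

lemma sum_list_le_weighted_sum:
  fixes I r :: "nat list"
  assumes "\<forall>n<length I. 1 \<le> r ! n"
  shows "sum_list I \<le> (\<Sum>n<length I. I ! n * r ! n)"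
  unfolding sum_list_sum_nth atLeast0LessThan using assms by (intro sum_mono) simp

text \<open>Every shape dominates the all-ones shape, which has core size 1 and factor size
  \<open>sum_list I\<close>. Hence the initial test of \<open>solve_subproblem\<close> rejects only
  subproblems without any solution.\<close>

lemma subfeasible_imp_bounds:
  assumes "subfeasible I U C C' r"
  shows "1 \<le> C" "real (sum_list I) \<le> C'"
proof -
  have "1 \<le> (\<Prod>n<length I. r ! n)"
    using assms by (intro prod_ge_1) (auto simp: subfeasible_def)
  then show "1 \<le> C" using assms by (simp add: subfeasible_def del: of_nat_prod)
  show "real (sum_list I) \<le> C'"
  proof -
    have "sum_list I \<le> (\<Sum>n<length I. I ! n * r ! n)"
      using assms by (intro sum_list_le_weighted_sum) (simp add: subfeasible_def)
    then have "real (sum_list I) \<le> real (\<Sum>n<length I. I ! n * r ! n)"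
      by (simp only: of_nat_le_iff)
    then show ?thesis using assms unfolding subfeasible_def by linarith
  qed
qed

text \<open>The truncated subtraction of naturals is exact here, as all entries are at least
  1.\<close>

lemma weighted_sum_shift:
  assumes "length r = length I" "\<forall>n<length I. 1 \<le> r ! n"
  shows "(\<Sum>n<length I. real (I ! n * (r ! n - 1))) =
    real (\<Sum>n<length I. I ! n * r ! n) - real (sum_list I)"
proof -
  have "(\<Sum>n<length I. real (I ! n * (r ! n - 1))) =
      (\<Sum>n<length I. real (I ! n * r ! n) - real (I ! n))"
    using assms by (intro sum.cong) (auto simp: of_nat_diff algebra_simps)
  then show ?thesis
    by (simp add: sum_subtractf sum_list_sum_nth atLeast0LessThan)
qed

lemma ln_prod_nth:
  assumes "\<forall>n<N. 1 \<le> r ! n"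
  shows "(\<Sum>n<N. ln (real (r ! n))) = ln (real (\<Prod>n<N. r ! n))"
  using assms by (subst of_nat_prod, subst ln_prod) (auto simp: Suc_le_eq)

section \<open>Value and cost of one subproblem\<close>

lemma solve_subproblem_infeasible:
  assumes "C < 1 \<or> C' < real (sum_list I)"
  shows "solve_subproblem solver \<epsilon> I a U C C' = (None, length I + 3)"
  using assms by (simp add: prod_eq_iff solve_subproblem_def)

text \<open>In the cost, \<open>sum_list (map snd its)\<close> pays for the profits, whose prefix
  sums are computed from scratch, and \<open>4 * length its\<close> pays for the logarithms, the
  factor weights (two operations each) and the part numbers.\<close>

lemma solve_subproblem_feasible:
  fixes I U C C' \<epsilon> a solver
  defines "its \<equiv> items U"
  defines "res \<equiv> solver \<epsilon> (map (\<lambda>(n, i). \<Sum>j<i. a ! n ! j) its)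
    [(map (\<lambda>(n, i). ln (real i)) its, ln C),
     (map (\<lambda>(n, i). real (I ! n * (i - 1))) its, C' - real (sum_list I))]
    (partition_query (map fst its))"
  assumes "1 \<le> C" "real (sum_list I) \<le> C'"
  shows "fst (solve_subproblem solver \<epsilon> I a U C C') = Some (decode (length U) its (fst res))"
    and "snd (solve_subproblem solver \<epsilon> I a U C C') =
      length I + 2 * length U + sum_list U + sum_list (map snd its) + 4 * length its +
      snd res + 2 * length (fst res) + 3"
proof -
  have "(\<lambda>(n :: nat, i). i) = (snd :: nat \<times> nat \<Rightarrow> nat)" by auto
  then show "snd (solve_subproblem solver \<epsilon> I a U C C') =
      length I + 2 * length U + sum_list U + sum_list (map snd its) + 4 * length its +
      snd res + 2 * length (fst res) + 3"
    using assms(3,4) by (simp add: solve_subproblem_def its_def res_def)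
qed (use assms(3,4) in \<open>simp add: solve_subproblem_def its_def res_def\<close>)

lemma sum_list_snd_items: "sum_list (map snd (items U)) \<le> (sum_list U)\<^sup>2"
proof -
  have "snd x \<le> sum_list U" if "x \<in> set (items U)" for x
    using that elem_le_sum_list[of "fst x" U] by (auto simp: set_items)
  then have "sum_list (map snd (items U)) \<le> sum_list (map (\<lambda>_. sum_list U) (items U))"
    by (intro sum_list_mono)
  then show ?thesis
    by (simp add: sum_list_triv length_items power2_eq_square)
qed

lemma tucker_instance_nth:
  assumes "tucker_instance I a c" "n < length I"
  shows "length (a ! n) = I ! n" "1 \<le> I ! n" "sorted_wrt (\<ge>) (a ! n)"
    "\<And>i. i < I ! n \<Longrightarrow> 0 \<le> a ! n ! i"
proof -
  have len: "length a = length I" and a: "map length a = I"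
    using assms by (auto simp: tucker_instance_def)
  show 1: "length (a ! n) = I ! n"
    using assms(2) len by (subst a[symmetric]) simp
  show "1 \<le> I ! n" "sorted_wrt (\<ge>) (a ! n)"
    using assms len by (auto simp: tucker_instance_def)
  have "a ! n \<in> set a" using assms(2) len by simp
  then show "0 \<le> a ! n ! i" if "i < I ! n" for i
    using assms(1) 1 that by (auto simp: tucker_instance_def)
qed

lemma length_le_sum_list: "\<forall>i\<in>set I. 1 \<le> i \<Longrightarrow> length I \<le> sum_list (I :: nat list)"
  by (induction I) auto

text \<open>The constants precede the accuracy and the instance, so the bound is uniform over all
  calls. The result \<open>None\<close> certifies infeasibility. The condition
  \<open>1 \<le> B\<close> is recorded for later, to bound \<open>sum_list I\<close> itself by
  \<open>sum_list I powr (B / \<epsilon>)\<close>.\<close>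

lemma solve_subproblem_ptas:
  assumes "budgeted_matroid_ptas 2 solver"
  shows "\<exists>A B :: real. 0 < A \<and> 1 \<le> B \<and>
    (\<forall>\<epsilon> I a c U C C'. 0 < \<epsilon> \<and> \<epsilon> < 1 / 3 \<and> tucker_instance I a c \<and>
      length U = length I \<and> (\<forall>n<length I. 1 \<le> U ! n \<and> U ! n \<le> I ! n) \<longrightarrow>
      (case fst (solve_subproblem solver \<epsilon> I a U C C') of
        None \<Rightarrow> \<forall>r. \<not> subfeasible I U C C' r
      | Some r \<Rightarrow> subfeasible I U C C' r \<and>
          (\<forall>r'. subfeasible I U C C' r' \<longrightarrow> (1 - \<epsilon>) * objective a r' \<le> objective a r)) \<and>
      real (snd (solve_subproblem solver \<epsilon> I a U C C')) \<le> A * real (sum_list I) powr (B / \<epsilon>))"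
proof -
  obtain D K :: real where "0 < D" "0 < K" and solver:
    "\<And>\<epsilon> profits constraints query indep q.
          0 < \<epsilon> \<and> \<epsilon> < 1 \<and> profits \<noteq> [] \<and> length constraints = 2 \<and>
          budgeted_instance indep profits constraints \<and>
          1 \<le> q \<and> oracle_for query (length profits) indep q \<Longrightarrow>
          (let (js, t) = solver \<epsilon> profits constraints query in
             distinct js \<and> budgeted_feasible indep constraints (set js) \<and>
             (\<forall>S. budgeted_feasible indep constraints S \<longrightarrow>
                (1 - \<epsilon>) * (\<Sum>j\<in>S. profits ! j) \<le> (\<Sum>j\<in>set js. profits ! j)) \<and>
             real t \<le> D * real q * real (length profits) powr (K * (real 2)\<^sup>2 / \<epsilon>))"
    using assms unfolding budgeted_matroid_ptas_def by blast
  \<comment> \<open>Two budgets give the solver the exponent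
    \<open>2\<^sup>2 * K / \<epsilon>\<close>, whence \<open>4 * K\<close>. The factor
    \<open>2 * D\<close> comes from the query cost \<open>m\<^sup>2 + 1\<close>, which is at most
    twice the square of \<open>sum_list I\<close>; 17 covers the remaining quadratic overhead with
    slack.\<close>
  have main: "(case fst (solve_subproblem solver \<epsilon> I a U C C') of
        None \<Rightarrow> \<forall>r. \<not> subfeasible I U C C' r
      | Some r \<Rightarrow> subfeasible I U C C' r \<and>
          (\<forall>r'. subfeasible I U C C' r' \<longrightarrow> (1 - \<epsilon>) * objective a r' \<le> objective a r)) \<and>
      real (snd (solve_subproblem solver \<epsilon> I a U C C')) \<le>
        (17 + 2 * D) * real (sum_list I) powr ((4 * K + 1) / \<epsilon>)"
    if eps: "0 < \<epsilon>" "\<epsilon> < 1 / 3" and inst: "tucker_instance I a c"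
      and U: "length U = length I" "\<forall>n<length I. 1 \<le> U ! n \<and> U ! n \<le> I ! n"
    for \<epsilon> I a c U C C'
  proof -
    define s where "s = sum_list I"
    define m where "m = length (items U)"
    have N: "1 \<le> length I" "length I \<le> s"
      using inst length_le_sum_list[of I] by (auto simp: tucker_instance_def s_def Suc_le_eq)
    have "length U \<le> m"
      unfolding m_def length_items using U
      by (intro length_le_sum_list) (auto simp: in_set_conv_nth)
    with N U have "1 \<le> m" by simp
    have "m \<le> s"
      using U unfolding m_def s_def length_items
      by (auto simp: sum_list_sum_nth intro!: sum_mono)
    have "m\<^sup>2 \<le> s\<^sup>2" using \<open>m \<le> s\<close> by (simp add: power_mono)
    have "1 \<le> s" using N by simp
    have "s \<le> s\<^sup>2" by (simp add: power2_eq_square)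
    have "1 \<le> s\<^sup>2" using \<open>1 \<le> s\<close> by simp
    \<comment> \<open>Since \<open>2 \<le> 1 / \<epsilon>\<close>, a factor \<open>s\<^sup>2\<close>
      only adds 1 to the numerator of the exponent.\<close>
    have s2: "real (s\<^sup>2) * real s powr (4 * K / \<epsilon>) \<le> real s powr ((4 * K + 1) / \<epsilon>)"
    proof -
      have "real (s\<^sup>2) = real s powr 2" using \<open>1 \<le> s\<close> by (simp add: powr_numeral)
      also have "\<dots> \<le> real s powr (1 / \<epsilon>)"
        using \<open>1 \<le> s\<close> eps by (intro powr_mono) (auto simp: field_simps)
      finally have "real (s\<^sup>2) * real s powr (4 * K / \<epsilon>) \<le>
          real s powr (1 / \<epsilon>) * real s powr (4 * K / \<epsilon>)"
        by (intro mult_right_mono) auto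
      then show ?thesis by (simp add: powr_add[symmetric] add_divide_distrib add.commute)
    qed
    have "1 \<le> real s powr (4 * K / \<epsilon>)"
      using \<open>1 \<le> s\<close> \<open>0 < K\<close> eps by (intro ge_one_powr_ge_zero) auto
    then have s2': "real (s\<^sup>2) \<le> real s powr ((4 * K + 1) / \<epsilon>)"
      using s2 mult_left_mono[of 1 "real s powr (4 * K / \<epsilon>)" "real (s\<^sup>2)"] by simp
    show ?thesis
    proof (cases "C < 1 \<or> C' < real (sum_list I)")
      case True
      have "real (length I + 3) \<le> 17 * real (s\<^sup>2)"
        using N \<open>s \<le> s\<^sup>2\<close> \<open>1 \<le> s\<^sup>2\<close> by linarith
      also have "\<dots> \<le> 17 * real s powr ((4 * K + 1) / \<epsilon>)" using s2' by simp
      also have "\<dots> \<le> (17 + 2 * D) * real s powr ((4 * K + 1) / \<epsilon>)"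
        using \<open>0 < D\<close> by (intro mult_right_mono) auto
      finally show ?thesis
        using True subfeasible_imp_bounds[of I U C C']
        by (fastforce simp: solve_subproblem_infeasible s_def)
    next
      case False
      then have CC: "1 \<le> C" "real (sum_list I) \<le> C'" by auto
      let ?its = "items U"
      let ?p = "\<lambda>n i. \<Sum>j<i. a ! n ! j"
      let ?part = "map fst ?its"
      let ?indep = "\<lambda>X. X \<subseteq> {..<m} \<and> inj_on ((!) ?part) X"
      let ?profits = "map (case_prod ?p) ?its"
      let ?cons = "[(map (\<lambda>(n, i). ln (real i)) ?its, ln C),
        (map (\<lambda>(n, i). real (I ! n * (i - 1))) ?its, C' - real (sum_list I))]"
      define js where "js = fst (solver \<epsilon> ?profits ?cons (partition_query ?part))"
      define t where "t = snd (solver \<epsilon> ?profits ?cons (partition_query ?part))"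
      have nonneg: "0 \<le> ?p n i" if "n < length I" "i \<le> U ! n" for n i
        using that tucker_instance_nth(4)[OF inst] U(2)
        by (intro sum_nonneg) (metis lessThan_iff order_less_le_trans)
      have "budgeted_instance ?indep ?profits ?cons"
        unfolding budgeted_instance_def
      proof (intro conjI)
        show "matroid {..<length ?profits} ?indep"
          by (simp add: m_def matroid_partition)
        show "\<forall>p\<in>set ?profits. 0 \<le> p"
          using nonneg U(1) by (auto simp: set_items)
      qed (use CC in \<open>auto simp: set_items\<close>)
      moreover have "oracle_for (partition_query ?part) (length ?profits) ?indep (m\<^sup>2 + 1)"
        using oracle_for_partition_query[of ?part m] by (simp add: m_def)
      moreover have "?profits \<noteq> []" using \<open>1 \<le> m\<close> by (auto simp: m_def)
      ultimately have sol: "distinct js" "budgeted_feasible ?indep ?cons (set js)"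
        "\<And>S. budgeted_feasible ?indep ?cons S \<Longrightarrow>
           (1 - \<epsilon>) * (\<Sum>j\<in>S. ?profits ! j) \<le> (\<Sum>j\<in>set js. ?profits ! j)"
        "real t \<le> D * real (m\<^sup>2 + 1) * real m powr (K * (real 2)\<^sup>2 / \<epsilon>)"
        using solver[of \<epsilon> ?profits ?cons ?indep "m\<^sup>2 + 1" "partition_query ?part"] eps
        by (auto simp: js_def t_def m_def Let_def case_prod_beta)
      \<comment> \<open>List lookups outside the ground set mean nothing, but such an
        \<open>S\<close> fails both sides by the inclusion in \<open>{..<m}\<close>.\<close>
      have feas_iff: "budgeted_feasible ?indep ?cons S \<longleftrightarrow>
          S \<subseteq> {..<m} \<and> inj_on (\<lambda>j. fst (?its ! j)) S \<and>
          (\<Sum>j\<in>S. (\<lambda>(n, i). ln (real i)) (?its ! j)) \<le> ln C \<and>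
          (\<Sum>j\<in>S. (\<lambda>(n, i). real (I ! n * (i - 1))) (?its ! j)) \<le> C' - real (sum_list I)" for S
      proof (cases "S \<subseteq> {..<m}")
        case True
        have "(\<Sum>j\<in>S. map g ?its ! j) = (\<Sum>j\<in>S. g (?its ! j))" for g :: "nat \<times> nat \<Rightarrow> real"
          using True by (intro sum.cong) (auto simp: m_def)
        moreover have "inj_on ((!) ?part) S \<longleftrightarrow> inj_on (\<lambda>j. fst (?its ! j)) S"
          using True by (intro inj_on_cong) (auto simp: m_def)
        ultimately show ?thesis using True by (auto simp: budgeted_feasible_def)
      qed (simp add: budgeted_feasible_def)
      have profits_nth: "(\<Sum>j\<in>S. ?profits ! j) = (\<Sum>j\<in>S. case_prod ?p (?its ! j))"
        if "S \<subseteq> {..<m}" for S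
        using that by (intro sum.cong) (auto simp: m_def)
      define r where "r = decode (length U) ?its js"
      note js = sol(2)[unfolded feas_iff]
      have mem: "fst (?its ! j) < length U \<and> 1 \<le> snd (?its ! j) \<and>
          snd (?its ! j) \<le> U ! fst (?its ! j)" if "j \<in> set js" for j
      proof -
        have "?its ! j \<in> set ?its" using that js by (auto simp: m_def intro!: nth_mem)
        then show ?thesis by (auto simp: set_items)
      qed
      have sum_r: "(\<Sum>n<length I. g n (r ! n)) = (\<Sum>j\<in>set js. case_prod g (?its ! j)) +
          (\<Sum>n\<in>{..<length I} - (\<lambda>j. fst (?its ! j)) ` set js. g n 1)"
        for g :: "nat \<Rightarrow> nat \<Rightarrow> real"
        unfolding r_def U(1)[symmetric]
        by (rule sum_decode) (use sol(1) js mem in auto)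
      have len_r: "length r = length I" using U by (simp add: r_def)
      have box: "1 \<le> r ! n \<and> r ! n \<le> U ! n" if "n < length I" for n
      proof (cases "n \<in> (\<lambda>j. fst (?its ! j)) ` set js")
        case True
        then obtain j where "j \<in> set js" "n = fst (?its ! j)" by blast
        then show ?thesis
          using mem[of j] sol(1) js unfolding r_def by (simp add: decode_nth_chosen)
      next
        case False
        then show ?thesis using that U by (simp add: r_def decode_nth_unchosen)
      qed
      \<comment> \<open>Coordinates left at 1 add \<open>ln 1 = 0\<close> here and factor weight 0
        in the second constraint, so both budgets pass from \<open>js\<close> to
        \<open>r\<close>.\<close>
      have "ln (real (\<Prod>n<length I. r ! n)) \<le> ln C"
        using js sum_r[of "\<lambda>n i. ln (real i)"] ln_prod_nth[of "length I" r] box by auto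
      moreover have "0 < real (\<Prod>n<length I. r ! n)"
        using box by (auto simp: Suc_le_eq intro!: prod_pos)
      ultimately have "real (\<Prod>n<length I. r ! n) \<le> C"
        using CC by (subst (asm) ln_le_cancel_iff) auto
      moreover have "real (\<Sum>n<length I. I ! n * r ! n) \<le> C'"
        using js sum_r[of "\<lambda>n i. real (I ! n * (i - 1))"] weighted_sum_shift[OF len_r] box
        by auto
      ultimately have sub: "subfeasible I U C C' r"
        using len_r box by (simp add: subfeasible_def)
      have approx: "(1 - \<epsilon>) * objective a r' \<le> objective a r" if r': "subfeasible I U C C' r'" for r'
      proof -
        have "\<forall>n<length U. 1 \<le> r' ! n \<and> r' ! n \<le> U ! n" "length r' = length I"
          using r' U by (auto simp: subfeasible_def)
        from sum_items[OF this(1)] obtain S where S: "S \<subseteq> {..<m}"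
            "inj_on (\<lambda>j. fst (?its ! j)) S"
          and sum_S: "\<And>g :: nat \<Rightarrow> nat \<Rightarrow> real.
            (\<Sum>j\<in>S. case_prod g (?its ! j)) = (\<Sum>n<length I. g n (r' ! n))"
          using U unfolding m_def by auto
        have "budgeted_feasible ?indep ?cons S"
          unfolding feas_iff sum_S
        proof (intro conjI S)
          have "real (\<Prod>n<length I. r' ! n) \<le> C" using r' by (simp add: subfeasible_def)
          moreover have "0 < real (\<Prod>n<length I. r' ! n)"
            using r' by (auto simp: subfeasible_def Suc_le_eq intro!: prod_pos)
          ultimately show "(\<Sum>n<length I. ln (real (r' ! n))) \<le> ln C"
            using r' CC by (subst ln_prod_nth) (auto simp: subfeasible_def simp del: of_nat_prod)
          show "(\<Sum>n<length I. real (I ! n * (r' ! n - 1))) \<le> C' - real (sum_list I)"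
            using r' by (subst weighted_sum_shift) (auto simp: subfeasible_def)
        qed
        from sol(3)[OF this] have "(1 - \<epsilon>) * (\<Sum>j\<in>S. case_prod ?p (?its ! j)) \<le>
            (\<Sum>j\<in>set js. case_prod ?p (?its ! j))"
          using S js by (simp only: profits_nth)
        also have "(\<Sum>j\<in>S. case_prod ?p (?its ! j)) = objective a r'"
          using sum_S[of ?p] \<open>length r' = length I\<close> by (simp add: objective_def)
        \<comment> \<open>Filling the missed parts with 1 can only add profit, because the entries
          of \<open>a\<close> are nonnegative.\<close>
        also have "(\<Sum>j\<in>set js. case_prod ?p (?its ! j)) \<le> (\<Sum>n<length I. ?p n (r ! n))"
        proof -
          have "0 \<le> (\<Sum>n\<in>{..<length I} - (\<lambda>j. fst (?its ! j)) ` set js. ?p n 1)"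
            using U by (intro sum_nonneg nonneg) auto
          then show ?thesis unfolding sum_r[of ?p] by linarith
        qed
        also have "\<dots> = objective a r" using len_r by (simp add: objective_def)
        finally show ?thesis .
      qed
      have "length js \<le> m"
        using sol(1) js card_mono[of "{..<m}" "set js"] by (simp add: distinct_card)
      have "real (m\<^sup>2 + 1) \<le> 2 * real (s\<^sup>2)"
        using \<open>m\<^sup>2 \<le> s\<^sup>2\<close> \<open>1 \<le> s\<^sup>2\<close> by linarith
      have "real t \<le> D * real (m\<^sup>2 + 1) * real m powr (4 * K / \<epsilon>)"
        using sol(4) by (simp add: mult.commute)
      also have "\<dots> \<le> D * (2 * real (s\<^sup>2)) * real s powr (4 * K / \<epsilon>)"
        using \<open>real (m\<^sup>2 + 1) \<le> 2 * real (s\<^sup>2)\<close> \<open>m \<le> s\<close> \<open>0 < D\<close> \<open>0 < K\<close> eps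
        by (intro mult_mono powr_mono2) (auto simp del: of_nat_power)
      also have "\<dots> \<le> 2 * D * real s powr ((4 * K + 1) / \<epsilon>)"
        using mult_left_mono[OF s2, of "2 * D"] \<open>0 < D\<close> by (simp add: mult_ac)
      finally have t: "real t \<le> 2 * D * real s powr ((4 * K + 1) / \<epsilon>)" .
      have "snd (solve_subproblem solver \<epsilon> I a U C C') \<le> 17 * s\<^sup>2 + t"
      proof -
        have "sum_list (map snd ?its) \<le> s\<^sup>2"
          using sum_list_snd_items[of U] \<open>m\<^sup>2 \<le> s\<^sup>2\<close>
          unfolding m_def length_items by (rule order_trans)
        moreover have "sum_list U = m" by (simp add: m_def length_items)
        ultimately show ?thesis
          unfolding solve_subproblem_feasible(2)[OF CC] js_def[symmetric] t_def[symmetric]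
            m_def[symmetric]
          using N U(1) \<open>length js \<le> m\<close> \<open>m \<le> s\<close> \<open>s \<le> s\<^sup>2\<close> \<open>1 \<le> s\<^sup>2\<close>
          by linarith
      qed
      then have "real (snd (solve_subproblem solver \<epsilon> I a U C C')) \<le> 17 * real (s\<^sup>2) + real t"
        by (simp only: of_nat_le_iff[where 'a = real, symmetric] of_nat_add of_nat_mult of_nat_numeral)
      also have "\<dots> \<le> (17 + 2 * D) * real s powr ((4 * K + 1) / \<epsilon>)"
        using t s2' by (simp add: distrib_right)
      finally have "real (snd (solve_subproblem solver \<epsilon> I a U C C')) \<le>
        (17 + 2 * D) * real s powr ((4 * K + 1) / \<epsilon>)" .
      then show ?thesis
        unfolding solve_subproblem_feasible(1)[OF CC] js_def[symmetric] r_def[symmetric]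
        using sub approx by (simp add: s_def)
    qed
  qed
  show ?thesis
    by (intro exI[of _ "17 + 2 * D"] exI[of _ "4 * K + 1"] conjI allI impI; (elim conjE)?)
      (use \<open>0 < D\<close> \<open>0 < K\<close> main in auto)
qed

section \<open>Timed collection and maximization\<close>

lemma set_collect: "set (fst (collect f xs)) = {y. \<exists>x\<in>set xs. fst (f x) = Some y}"
  by (induction xs) (auto split: option.splits)

lemma length_collect: "length (fst (collect f xs)) \<le> length xs"
  by (induction xs) (auto split: option.splits)

lemma collect_time:
  assumes "\<And>x. x \<in> set xs \<Longrightarrow> real (snd (f x)) \<le> T"
  shows "real (snd (collect f xs)) \<le> (T + 1) * real (length xs) + 1"
  using assms
proof (induction xs)
  case (Cons x xs)
  from Cons.IH Cons.prems have "real (snd (collect f xs)) \<le> (T + 1) * real (length xs) + 1"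
    by simp
  moreover have "real (snd (f x)) \<le> T" using Cons.prems by simp
  ultimately show ?case by (simp add: algebra_simps)
qed simp

lemma timed_argmax_correct:
  assumes "xs \<noteq> []"
  shows "\<exists>y. fst (timed_argmax f xs) = Some y \<and> y \<in> set xs \<and> (\<forall>x\<in>set xs. fst (f x) \<le> fst (f y))"
  using assms
proof (induction xs)
  case (Cons x xs)
  show ?case
  proof (cases "xs = []")
    case False
    with Cons.IH obtain y where
      "fst (timed_argmax f xs) = Some y" "y \<in> set xs" "\<forall>x\<in>set xs. fst (f x) \<le> fst (f y)"
      by blast
    then show ?thesis by auto
  qed simp
qed simp

text \<open>The value of the current best is recomputed at every comparison, hence
  \<open>2 * T\<close>. That best element lies in the tail by correctness, so the bound
  \<open>T\<close> applies to it too.\<close>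

lemma timed_argmax_time:
  assumes "\<And>x. x \<in> set xs \<Longrightarrow> snd (f x) \<le> T"
  shows "snd (timed_argmax f xs) \<le> (2 * T + 1) * length xs + 1"
  using assms
proof (induction xs)
  case (Cons x xs)
  have IH: "snd (timed_argmax f xs) \<le> (2 * T + 1) * length xs + 1"
    using Cons by simp
  have x: "snd (f x) \<le> T" using Cons.prems by simp
  show ?case
  proof (cases "xs = []")
    case False
    then obtain y where y: "fst (timed_argmax f xs) = Some y" "y \<in> set xs"
      using timed_argmax_correct[of xs f] by blast
    then have "snd (f y) \<le> T" using Cons.prems by simp
    then show ?thesis using IH x y by simp
  qed simp
qed simp

section \<open>Rounding a shape into an enumerated subproblem\<close>

text \<open>The average of the first \<open>k\<close> entries is at least the average of the first
  \<open>n\<close>: the \<open>k\<close>-th entry \<open>b\<close> bounds the first \<open>k\<close>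
  from below and the later ones from above. The cross-multiplied form avoids division by
  zero.\<close>

lemma sum_prefix_ge_fraction:
  fixes xs :: "real list"
  assumes "sorted_wrt (\<ge>) xs" "k \<le> n" "n \<le> length xs"
  shows "real k * (\<Sum>i<n. xs ! i) \<le> real n * (\<Sum>i<k. xs ! i)"
proof (cases "k = 0")
  case False
  define b where "b = xs ! (k - 1)"
  have anti: "xs ! j \<le> xs ! i" if "i \<le> j" "j < length xs" for i j
    using that assms(1) by (cases "i = j") (auto simp: sorted_wrt_iff_nth_less)
  have "(\<Sum>i\<in>{k..<n}. xs ! i) \<le> (\<Sum>i\<in>{k..<n}. b)"
    unfolding b_def using assms by (intro sum_mono anti) auto
  then have 1: "(\<Sum>i\<in>{k..<n}. xs ! i) \<le> real (n - k) * b" by simp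
  have "(\<Sum>i<k. b) \<le> (\<Sum>i<k. xs ! i)"
    unfolding b_def using assms False by (intro sum_mono anti) auto
  then have 2: "real k * b \<le> (\<Sum>i<k. xs ! i)" by simp
  have "(\<Sum>i<n. xs ! i) = (\<Sum>i<k. xs ! i) + (\<Sum>i\<in>{k..<n}. xs ! i)"
    using sum.atLeastLessThan_concat[of 0 k n "(!) xs"] assms by (simp add: atLeast0LessThan)
  then have "real k * (\<Sum>i<n. xs ! i) \<le> real k * (\<Sum>i<k. xs ! i) + real k * (real (n - k) * b)"
    using 1 by (simp add: distrib_left mult_left_mono)
  also have "real k * (real (n - k) * b) \<le> real (n - k) * (\<Sum>i<k. xs ! i)"
    using mult_left_mono[OF 2, of "real (n - k)"] by (simp add: mult_ac)
  finally show ?thesis using assms(2) by (simp add: of_nat_diff algebra_simps)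
qed (use assms in simp)

lemma objective_list_update:
  assumes "n < length r"
  shows "objective a (r[n := k]) = objective a r - (\<Sum>i<r ! n. a ! n ! i) + (\<Sum>i<k. a ! n ! i)"
proof -
  have n: "n \<in> {..<length r}" using assms by simp
  have "(\<Sum>m\<in>{..<length r} - {n}. \<Sum>i<r[n := k] ! m. a ! m ! i) =
      (\<Sum>m\<in>{..<length r} - {n}. \<Sum>i<r ! m. a ! m ! i)"
    by (intro sum.cong) auto
  then show ?thesis
    using assms by (simp add: objective_def sum.remove[OF finite_lessThan n])
qed

lemma objective_nonneg:
  assumes "tucker_instance I a c" "length r = length I" "\<forall>n<length I. r ! n \<le> I ! n"
  shows "0 \<le> objective a r"
  unfolding objective_def
  using assms tucker_instance_nth(4)[OF assms(1)]
  by (auto intro!: sum_nonneg simp: order_less_le_trans)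

text \<open>
  Prefix sums of a non-increasing sequence are concave, so \<open>R' = \<lfloor>R / (1 + \<epsilon>)\<rfloor>\<close> keeps a fraction
  \<open>R' / R \<ge> 1 - \<epsilon> - 1 / R \<ge> 1 - 2\<epsilon>\<close> of the contribution of the coordinate \<open>R\<close>.
\<close>

lemma large_subproblem_exists:
  assumes inst: "tucker_instance I a c" and eps: "0 < \<epsilon>" "\<epsilon> < 1 / 3"
    and r: "feasible I c r" and n: "n < length I" "1 / \<epsilon> < real (r ! n)"
  obtains k r' where "k \<le> nat \<lfloor>log (1 + \<epsilon>) c\<rfloor>"
    "subfeasible I I ((1 + \<epsilon>) ^ k) (c - (1 + \<epsilon>) ^ k) r'"
    "(1 - 2 * \<epsilon>) * objective a r \<le> objective a r'"
proof -
  let ?N = "length I"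
  define P where "P = (\<Prod>m<?N. r ! m)"
  define Q where "Q = (\<Prod>m\<in>{..<?N} - {n}. r ! m)"
  define R where "R = real (r ! n)"
  define R' where "R' = nat \<lfloor>R / (1 + \<epsilon>)\<rfloor>"
  define r' where "r' = r[n := R']"
  \<comment> \<open>The choice gives
    \<open>(1 + \<epsilon>) ^ k \<le> P < (1 + \<epsilon>) ^ (k + 1)\<close>. The lower inequality
    leaves at least \<open>c - P\<close> for the factors; by the upper one, a single division by
    \<open>1 + \<epsilon>\<close> makes the core fit.\<close>
  define k where "k = nat \<lfloor>log (1 + \<epsilon>) (real P)\<rfloor>"
  have len: "length r = ?N" and box: "\<And>m. m < ?N \<Longrightarrow> 1 \<le> r ! m \<and> r ! m \<le> I ! m"
    and budget: "real P + real (\<Sum>m<?N. I ! m * r ! m) \<le> c"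
    using r by (auto simp: feasible_def P_def)
  have "1 \<le> P" unfolding P_def using box by (intro prod_ge_1) auto
  have "real P \<le> c" using budget by linarith
  have "0 \<le> log (1 + \<epsilon>) (real P)" using \<open>1 \<le> P\<close> eps by simp
  then have k: "real k \<le> log (1 + \<epsilon>) (real P)" "log (1 + \<epsilon>) (real P) < real k + 1"
    unfolding k_def by linarith+
  have "(1 + \<epsilon>) powr real k \<le> real P"
    using k(1) \<open>1 \<le> P\<close> eps by (simp add: le_log_iff)
  then have k_le: "(1 + \<epsilon>) ^ k \<le> real P" using eps by (simp add: powr_realpow)
  have "real P < (1 + \<epsilon>) powr (real k + 1)"
    using k(2) \<open>1 \<le> P\<close> eps by (simp add: log_less_iff)
  then have k_gr: "real P < (1 + \<epsilon>) ^ k * (1 + \<epsilon>)"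
    using eps by (simp add: powr_realpow powr_add)
  \<comment> \<open>This keeps the shrunk coordinate legitimate: \<open>R > 3\<close> exceeds
    \<open>1 + \<epsilon>\<close>, so \<open>R'\<close> is at least 1.\<close>
  have "3 < 1 / \<epsilon>" using eps by (simp add: field_simps)
  then have "R > 3" using n(2) by (simp add: R_def)
  then have "1 \<le> R / (1 + \<epsilon>)" using eps by (simp add: field_simps)
  then have R': "real R' \<le> R / (1 + \<epsilon>)" "R / (1 + \<epsilon>) - 1 < real R'" "1 \<le> R'"
    unfolding R'_def by linarith+
  have "R / (1 + \<epsilon>) \<le> R" using eps \<open>R > 3\<close> by (simp add: field_simps)
  then have R'_le: "R' \<le> r ! n" using R'(1) unfolding R_def by linarith
  have r'_nth: "r' ! m = (if m = n then R' else r ! m)" if "m < ?N" for m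
    using that len by (simp add: r'_def nth_list_update)
  have "P = r ! n * Q" using n by (simp add: P_def Q_def prod.remove)
  have "(\<Prod>m<?N. r' ! m) = r' ! n * (\<Prod>m\<in>{..<?N} - {n}. r' ! m)"
    using n by (simp add: prod.remove)
  also have "\<dots> = R' * Q"
    unfolding Q_def using n by (auto simp: r'_nth intro!: prod.cong)
  finally have "real (\<Prod>m<?N. r' ! m) = real R' * real Q" by simp
  also have "\<dots> \<le> R / (1 + \<epsilon>) * real Q"
    using R' by (intro mult_right_mono) auto
  also have "\<dots> = real P / (1 + \<epsilon>)" by (simp add: \<open>P = r ! n * Q\<close> R_def)
  also have "\<dots> \<le> (1 + \<epsilon>) ^ k" using k_gr eps by (simp add: field_simps)
  finally have 1: "real (\<Prod>m<?N. r' ! m) \<le> (1 + \<epsilon>) ^ k" .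
  have "(\<Sum>m<?N. I ! m * r' ! m) \<le> (\<Sum>m<?N. I ! m * r ! m)"
    using R'_le by (intro sum_mono) (auto simp: r'_nth)
  then have "real (\<Sum>m<?N. I ! m * r' ! m) \<le> c - (1 + \<epsilon>) ^ k"
    using budget k_le by linarith
  moreover have "\<forall>m<?N. 1 \<le> r' ! m \<and> r' ! m \<le> I ! m"
    using box R'(3) R'_le n by (auto simp: r'_nth intro: order_trans)
  ultimately have sub: "subfeasible I I ((1 + \<epsilon>) ^ k) (c - (1 + \<epsilon>) ^ k) r'"
    using 1 len by (simp add: subfeasible_def r'_def)
  have "log (1 + \<epsilon>) (real P) \<le> log (1 + \<epsilon>) c"
    using \<open>real P \<le> c\<close> \<open>1 \<le> P\<close> eps by (intro log_mono) auto
  then have "k \<le> nat \<lfloor>log (1 + \<epsilon>) c\<rfloor>"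
    unfolding k_def by (intro nat_mono floor_mono)
  moreover have "(1 - 2 * \<epsilon>) * objective a r \<le> objective a r'"
  proof -
    let ?p = "\<lambda>i. \<Sum>j<i. a ! n ! j"
    have p_nonneg: "0 \<le> ?p i" if "i \<le> I ! n" for i
      using tucker_instance_nth(4)[OF inst n(1)] that by (intro sum_nonneg) auto
    have "(1 - \<epsilon>) * (1 + \<epsilon>) \<le> 1" using eps by (simp add: algebra_simps)
    then have "1 - \<epsilon> \<le> 1 / (1 + \<epsilon>)" using eps by (simp add: pos_le_divide_eq)
    then have "R * (1 - \<epsilon>) \<le> R / (1 + \<epsilon>)"
      using mult_left_mono[of "1 - \<epsilon>" "1 / (1 + \<epsilon>)" R] \<open>R > 3\<close> by simp
    moreover have "1 \<le> R * \<epsilon>" using n(2) eps by (simp add: R_def field_simps)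
    ultimately have "R * (1 - 2 * \<epsilon>) \<le> real R'"
      using R'(2) by (simp add: algebra_simps)
    then have "R * (1 - 2 * \<epsilon>) * ?p (r ! n) \<le> real R' * ?p (r ! n)"
      using p_nonneg box n by (intro mult_right_mono) auto
    also have "\<dots> \<le> R * ?p R'"
      unfolding R_def using tucker_instance_nth[OF inst n(1)] R'_le box n
      by (intro sum_prefix_ge_fraction) auto
    finally have "(1 - 2 * \<epsilon>) * ?p (r ! n) \<le> ?p R'"
      using \<open>R > 3\<close> by (simp add: mult.assoc)
    \<comment> \<open>Coordinate 0 is no legal choice, but it isolates the contribution of the other
      coordinates. As this is nonnegative, the loss at \<open>n\<close> is also a
      \<open>2 * \<epsilon>\<close> fraction of the whole objective at most.\<close>
    moreover have "0 \<le> objective a (r[n := 0])"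
      using inst len box n by (intro objective_nonneg) (auto simp: nth_list_update)
    then have "?p (r ! n) \<le> objective a r"
      using n len by (simp add: objective_list_update)
    then have "2 * \<epsilon> * ?p (r ! n) \<le> 2 * \<epsilon> * objective a r"
      using eps by (intro mult_left_mono) auto
    ultimately show ?thesis
      using n len by (simp add: r'_def objective_list_update algebra_simps)
  qed
  ultimately show ?thesis using sub that by blast
qed

text \<open>The shape is kept unchanged, so nothing is lost. Its factor size lies in the range
  because each term \<open>I ! n * r ! n\<close> is at most \<open>h * I ! n\<close>.\<close>

lemma small_subproblem_exists:
  assumes inst: "tucker_instance I a c" and r: "feasible I c r"
    and small: "\<forall>n<length I. r ! n \<le> h"
  obtains cf where "cf \<in> {1..h * sum_list I}"
    "subfeasible I (map (min h) I) (c - real cf) (real cf) r"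
proof -
  let ?cf = "\<Sum>n<length I. I ! n * r ! n"
  have "sum_list I \<le> ?cf"
    using r by (intro sum_list_le_weighted_sum) (auto simp: feasible_def)
  moreover have "1 \<le> sum_list I"
    using inst length_le_sum_list[of I] by (auto simp: tucker_instance_def Suc_le_eq)
  moreover have "?cf \<le> (\<Sum>n<length I. h * I ! n)"
    using small by (intro sum_mono) auto
  then have "?cf \<le> h * sum_list I"
    by (simp add: sum_list_sum_nth atLeast0LessThan sum_distrib_left)
  ultimately have "?cf \<in> {1..h * sum_list I}" by simp
  moreover have "subfeasible I (map (min h) I) (c - real ?cf) (real ?cf) r"
    using r small by (auto simp: feasible_def subfeasible_def)
  ultimately show ?thesis using that by blast
qed

lemma subfeasible_imp_feasible:
  assumes "subfeasible I U C C' r" "C + C' \<le> c" "\<forall>n<length I. U ! n \<le> I ! n"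
  shows "feasible I c r"
  using assms by (force simp: subfeasible_def feasible_def)

section \<open>Approximation ratio and total running time\<close>

theorem theorem4p6:
  fixes solver :: matroid_solver
  assumes "budgeted_matroid_ptas 2 solver"
  shows "\<exists>A B :: real. 0 < A \<and> 0 < B \<and>
    (\<forall>\<epsilon> I a c. 0 < \<epsilon> \<and> \<epsilon> < 1 / 3 \<and> tucker_instance I a c \<longrightarrow>
      (\<exists>r t. tucker_packing_solver solver \<epsilon> I a c = (Some r, t) \<and>
         feasible I c r \<and>
         (\<forall>r_opt. optimal I a c r_opt \<longrightarrow>
            objective a r \<ge> (1 - 3 * \<epsilon>) * objective a r_opt) \<and>
         real t \<le> A * (log (1 + \<epsilon>) c + real_of_int \<lceil>1 / \<epsilon>\<rceil> * real (sum_list I))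
                    * real (sum_list I) powr (B / \<epsilon>)))"
proof -
  obtain A B :: real where "0 < A" "1 \<le> B" and ptas:
    "\<And>\<epsilon> I a c U C C'. 0 < \<epsilon> \<and> \<epsilon> < 1 / 3 \<and> tucker_instance I a c \<and>
      length U = length I \<and> (\<forall>n<length I. 1 \<le> U ! n \<and> U ! n \<le> I ! n) \<Longrightarrow>
      (case fst (solve_subproblem solver \<epsilon> I a U C C') of
        None \<Rightarrow> \<forall>r. \<not> subfeasible I U C C' r
      | Some r \<Rightarrow> subfeasible I U C C' r \<and>
          (\<forall>r'. subfeasible I U C C' r' \<longrightarrow> (1 - \<epsilon>) * objective a r' \<le> objective a r)) \<and>
      real (snd (solve_subproblem solver \<epsilon> I a U C C')) \<le> A * real (sum_list I) powr (B / \<epsilon>)"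
    using solve_subproblem_ptas[OF assms] by blast
  have main: "\<exists>r t. tucker_packing_solver solver \<epsilon> I a c = (Some r, t) \<and> feasible I c r \<and>
         (\<forall>r_opt. optimal I a c r_opt \<longrightarrow>
            objective a r \<ge> (1 - 3 * \<epsilon>) * objective a r_opt) \<and>
         real t \<le> (2 * A + 34) * (log (1 + \<epsilon>) c + real_of_int \<lceil>1 / \<epsilon>\<rceil> * real (sum_list I))
                    * real (sum_list I) powr (B / \<epsilon>)"
    if eps: "0 < \<epsilon>" "\<epsilon> < 1 / 3" and inst: "tucker_instance I a c" for \<epsilon> I a c
  proof -
    define h where "h = nat \<lceil>1 / \<epsilon>\<rceil>"
    define s where "s = sum_list I"
    define U where "U = map (min h) I"
    define k_max where "k_max = nat \<lfloor>log (1 + \<epsilon>) c\<rfloor>"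
    define small where "small = (\<lambda>cf. solve_subproblem solver \<epsilon> I a U (c - real cf) (real cf))"
    define large where "large = (\<lambda>cc. solve_subproblem solver \<epsilon> I a I cc (c - cc))"
    define cfs where "cfs = [1..<Suc (h * s)]"
    define ccs where "ccs = map (\<lambda>k. (1 + \<epsilon>) ^ k) [0..<Suc k_max]"
    define S where "S = fst (collect small cfs) @ fst (collect large ccs)"
    define T where "T = A * real s powr (B / \<epsilon>)"
    have "3 < 1 / \<epsilon>" using eps by (simp add: field_simps)
    then have h: "1 \<le> h" "1 / \<epsilon> \<le> real h" "real_of_int \<lceil>1 / \<epsilon>\<rceil> = real h"
      unfolding h_def by linarith+
    have lenU: "length U = length I" by (simp add: U_def)
    have I1: "\<forall>n<length I. 1 \<le> I ! n" using tucker_instance_nth(2)[OF inst] by blast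
    have U1: "\<forall>n<length I. 1 \<le> U ! n \<and> U ! n \<le> I ! n" using I1 h by (simp add: U_def)
    have small_spec: "case fst (small cf) of
        None \<Rightarrow> \<forall>r. \<not> subfeasible I U (c - real cf) (real cf) r
      | Some r \<Rightarrow> subfeasible I U (c - real cf) (real cf) r \<and>
          (\<forall>r'. subfeasible I U (c - real cf) (real cf) r' \<longrightarrow>
            (1 - \<epsilon>) * objective a r' \<le> objective a r)"
      and small_time: "real (snd (small cf)) \<le> T" for cf
      using ptas[of \<epsilon> I a c U "c - real cf" "real cf"] eps inst lenU U1
      by (simp_all add: small_def T_def s_def)
    have large_spec: "case fst (large cc) of
        None \<Rightarrow> \<forall>r. \<not> subfeasible I I cc (c - cc) r
      | Some r \<Rightarrow> subfeasible I I cc (c - cc) r \<and>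
          (\<forall>r'. subfeasible I I cc (c - cc) r' \<longrightarrow>
            (1 - \<epsilon>) * objective a r' \<le> objective a r)"
      and large_time: "real (snd (large cc)) \<le> T" for cc
      using ptas[of \<epsilon> I a c I cc "c - cc"] eps inst I1
      by (simp_all add: large_def T_def s_def)
    have S_feasible: "feasible I c r" if "r \<in> set S" for r
    proof -
      from that consider cf where "fst (small cf) = Some r"
        | cc where "fst (large cc) = Some r"
        by (auto simp: S_def set_collect)
      then show ?thesis
      proof cases
        case 1
        with small_spec[of cf]
        show ?thesis using U1 by (auto intro!: subfeasible_imp_feasible[of I U])
      next
        case 2
        with large_spec[of cc]
        show ?thesis by (auto intro!: subfeasible_imp_feasible[of I I])
      qed
    qed
    have S_approx: "\<exists>r\<in>set S. (1 - 3 * \<epsilon>) * objective a r' \<le> objective a r"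
      if r': "feasible I c r'" for r'
    proof -
      have obj: "0 \<le> objective a r'"
        using r' inst by (intro objective_nonneg) (auto simp: feasible_def)
      show ?thesis
      proof (cases "\<forall>n<length I. r' ! n \<le> h")
        case True
        obtain cf where "cf \<in> {1..h * sum_list I}"
          and sub: "subfeasible I U (c - real cf) (real cf) r'"
          unfolding U_def by (rule small_subproblem_exists[OF inst r' True])
        then have cf: "cf \<in> set cfs" by (simp add: cfs_def s_def del: upt_Suc)
        from sub obtain r where r: "fst (small cf) = Some r"
          "(1 - \<epsilon>) * objective a r' \<le> objective a r"
          using small_spec[of cf] by (auto split: option.splits)
        moreover have "(1 - 3 * \<epsilon>) * objective a r' \<le> (1 - \<epsilon>) * objective a r'"
          using obj eps by (intro mult_right_mono) auto
        ultimately show ?thesis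
          using cf by (intro bexI[of _ r]) (auto simp: S_def set_collect)
      next
        case False
        then obtain n where n: "n < length I" "h < r' ! n" by (auto simp: not_le)
        then have "1 / \<epsilon> < real (r' ! n)" using h(2) by linarith
        then obtain k r'' where
          k: "k \<le> k_max" "subfeasible I I ((1 + \<epsilon>) ^ k) (c - (1 + \<epsilon>) ^ k) r''"
          and r'': "(1 - 2 * \<epsilon>) * objective a r' \<le> objective a r''"
          unfolding k_max_def by (rule large_subproblem_exists[OF inst eps r' n(1)])
        then obtain r where r: "fst (large ((1 + \<epsilon>) ^ k)) = Some r"
          "(1 - \<epsilon>) * objective a r'' \<le> objective a r"
          using large_spec[of "(1 + \<epsilon>) ^ k"] by (auto split: option.splits)
        \<comment> \<open>The losses of rounding and of solving multiply; the surplus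
          \<open>2 * \<epsilon>\<^sup>2\<close> is dropped.\<close>
        have "1 - 3 * \<epsilon> \<le> (1 - \<epsilon>) * (1 - 2 * \<epsilon>)" using eps by (simp add: algebra_simps)
        then have "(1 - 3 * \<epsilon>) * objective a r' \<le> (1 - \<epsilon>) * (1 - 2 * \<epsilon>) * objective a r'"
          using obj by (rule mult_right_mono)
        also have "\<dots> \<le> (1 - \<epsilon>) * objective a r''"
          using mult_left_mono[OF r'', of "1 - \<epsilon>"] eps by (simp add: mult.assoc)
        also note r(2)
        finally have "(1 - 3 * \<epsilon>) * objective a r' \<le> objective a r" .
        moreover have "(1 + \<epsilon>) ^ k \<in> set ccs" using k(1) by (auto simp: ccs_def simp del: upt_Suc)
        ultimately show ?thesis
          using r(1) by (intro bexI[of _ r]) (auto simp: S_def set_collect)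
      qed
    qed
    \<comment> \<open>The lower bound on \<open>c\<close> says precisely that the all-ones shape is
      feasible. Applying \<open>S_approx\<close> to it shows that some subproblem returned a shape,
      so the solver does not answer \<open>None\<close>.\<close>
    have "feasible I c (replicate (length I) 1)"
      using inst I1
      by (auto simp: feasible_def tucker_instance_def sum_list_sum_nth atLeast0LessThan)
    from S_approx[OF this] have "S \<noteq> []" by auto
    from timed_argmax_correct[OF this, of "timed_objective a"] obtain r where
      r: "fst (timed_argmax (timed_objective a) S) = Some r" "r \<in> set S"
      and r_max: "\<forall>x\<in>set S. objective a x \<le> objective a r"
      by (auto simp: timed_objective_def)
    define t where "t = snd (tucker_packing_solver solver \<epsilon> I a c)"
    have res: "tucker_packing_solver solver \<epsilon> I a c = (Some r, t)"
      using r(1)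
      by (simp add: prod_eq_iff t_def tucker_packing_solver_def S_def small_def large_def
          cfs_def ccs_def h_def s_def U_def k_max_def del: upt_Suc)
    have t_eq: "t = 2 + 2 * length I + h * s + snd (collect small cfs) + 2 + (k_max + 1) +
        snd (collect large ccs) + length (fst (collect small cfs)) +
        snd (timed_argmax (timed_objective a) S)"
      by (simp add: t_def tucker_packing_solver_def S_def small_def large_def
          cfs_def ccs_def h_def s_def U_def k_max_def del: upt_Suc)
    have len: "length cfs = h * s" "length ccs = k_max + 1"
      by (simp_all add: cfs_def ccs_def del: upt_Suc)
    \<comment> \<open>The number of subproblems; the extra 1 accounts for the exponent 0 in the
      large phase.\<close>
    define M where "M = h * s + k_max + 1"
    have "1 \<le> length I" "length I \<le> s"
      using inst length_le_sum_list[of I] by (auto simp: tucker_instance_def s_def Suc_le_eq)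
    then have "1 \<le> s" by simp
    have "snd (timed_objective a x) \<le> 2 * s" if "x \<in> set S" for x
    proof -
      have "length x = length I" "\<forall>n<length I. x ! n \<le> I ! n"
        using S_feasible[OF that] by (auto simp: feasible_def)
      then have "sum_list x \<le> s"
        by (auto simp: s_def sum_list_sum_nth intro!: sum_mono)
      then show ?thesis
        using \<open>length x = length I\<close> \<open>length I \<le> s\<close> by (simp add: timed_objective_def)
    qed
    then have "snd (timed_argmax (timed_objective a) S) \<le> (2 * (2 * s) + 1) * length S + 1"
      by (rule timed_argmax_time)
    also have "\<dots> \<le> (4 * s + 1) * M + 1"
    proof -
      have "length S \<le> M"
        using length_collect[of small cfs] length_collect[of large ccs]
        by (simp add: S_def M_def len)
      then show ?thesis using mult_le_mono2[of "length S" M "4 * s + 1"] by simp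
    qed
    finally have "snd (timed_argmax (timed_objective a) S) \<le> (4 * s + 1) * M + 1" .
    then have "real (snd (timed_argmax (timed_objective a) S)) \<le> real ((4 * s + 1) * M + 1)"
      by (simp only: of_nat_le_iff)
    then have argmax_t: "real (snd (timed_argmax (timed_objective a) S)) \<le>
        (4 * real s + 1) * real M + 1"
      by (simp add: algebra_simps)
    have small_t: "real (snd (collect small cfs)) \<le> (T + 1) * real (h * s) + 1"
      using collect_time[of cfs small T] small_time by (simp add: len)
    have large_t: "real (snd (collect large ccs)) \<le> (T + 1) * real (k_max + 1) + 1"
      using collect_time[of ccs large T] large_time by (simp add: len)
    have len_small: "real (length (fst (collect small cfs))) \<le> real (h * s)"
      using length_collect[of small cfs] by (simp only: len of_nat_le_iff)
    have "real t \<le> (T + 1) * real M + (4 * real s + 1) * real M + 2 * real M + 2 * real s + 7"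
    proof -
      have "(T + 1) * real M = (T + 1) * real (h * s) + (T + 1) * real (k_max + 1)"
        by (simp add: M_def algebra_simps)
      moreover have "real M = real (h * s) + real k_max + 1" by (simp add: M_def)
      moreover have "real (length I) \<le> real s" using \<open>length I \<le> s\<close> by simp
      moreover have "real t = 2 + 2 * real (length I) + real (h * s) +
          real (snd (collect small cfs)) + 2 + (real k_max + 1) + real (snd (collect large ccs)) +
          real (length (fst (collect small cfs))) +
          real (snd (timed_argmax (timed_objective a) S))"
        unfolding t_eq by simp
      ultimately show ?thesis
        using small_t large_t argmax_t len_small by linarith
    qed
    \<comment> \<open>Apart from \<open>T * M\<close> there remain \<open>4 * s * M\<close>,
      \<open>4 * M\<close>, \<open>2 * s\<close> and 7. Each of \<open>M\<close>, \<open>s\<close>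
      and 1 is at most \<open>s * M\<close>, and 4 + 4 + 2 + 7 = 17.\<close>
    also have "\<dots> \<le> (T + 17 * real s) * real M"
    proof -
      have "1 \<le> real M" "1 \<le> real s" using \<open>1 \<le> s\<close> by (simp_all add: M_def)
      moreover from this have "real s \<le> real s * real M" "real M \<le> real s * real M"
        by simp_all
      ultimately show ?thesis unfolding distrib_right mult.assoc mult_1_left by linarith
    qed
    also have "\<dots> \<le> ((A + 17) * real s powr (B / \<epsilon>)) *
        (2 * (log (1 + \<epsilon>) c + real_of_int \<lceil>1 / \<epsilon>\<rceil> * real s))"
    proof (rule mult_mono)
      have "real s = real s powr 1" using \<open>1 \<le> s\<close> by simp
      also have "\<dots> \<le> real s powr (B / \<epsilon>)"
        using \<open>1 \<le> s\<close> \<open>1 \<le> B\<close> eps by (intro powr_mono) (auto simp: field_simps)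
      finally show "T + 17 * real s \<le> (A + 17) * real s powr (B / \<epsilon>)"
        by (simp add: T_def distrib_right)
      have "1 \<le> c" using inst by (simp add: tucker_instance_def)
      then have "0 \<le> log (1 + \<epsilon>) c" using eps by simp
      then have "real k_max \<le> log (1 + \<epsilon>) c" unfolding k_max_def by linarith
      \<comment> \<open>This absorbs the extra 1 in \<open>M\<close> into a second copy of
        \<open>h * s\<close>, which is why the bound carries a factor 2 and the final constant is
        \<open>2 * (A + 17)\<close>.\<close>
      moreover have "1 \<le> h * s" using h(1) \<open>1 \<le> s\<close> by simp
      then have "1 \<le> real h * real s" by (metis of_nat_1 of_nat_le_iff of_nat_mult)
      ultimately show "real M \<le> 2 * (log (1 + \<epsilon>) c + real_of_int \<lceil>1 / \<epsilon>\<rceil> * real s)"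
        using \<open>0 \<le> log (1 + \<epsilon>) c\<close> by (simp add: M_def h(3))
    qed (use \<open>0 < A\<close> in auto)
    finally have "real t \<le> (2 * A + 34) *
        (log (1 + \<epsilon>) c + real_of_int \<lceil>1 / \<epsilon>\<rceil> * real s) * real s powr (B / \<epsilon>)"
      by (simp add: algebra_simps)
    moreover have "\<forall>r_opt. optimal I a c r_opt \<longrightarrow>
        objective a r \<ge> (1 - 3 * \<epsilon>) * objective a r_opt"
      using S_approx r_max by (fastforce simp: optimal_def intro: order_trans)
    ultimately show ?thesis
      using res S_feasible[OF r(2)] unfolding s_def by blast
  qed
  show ?thesis
    using \<open>0 < A\<close> \<open>1 \<le> B\<close> main
    by (intro exI[of _ "2 * A + 34"] exI[of _ B]) auto
qed

end
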